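(* Let $s\ge 1$, $n\ge 2$, $d=sn$, $w^*>0$, $\alpha>0$, and consider a depth-$L$ model $\boldsymbol W_{L:1}=\boldsymbol W_L\cdots\boldsymbol W_1$ with $\boldsymbol W_l\in\mathbb R^{d\times d}$, where every factor is initialized as the matrix $\boldsymbol W_l(0)$ with diagonal entries $\alpha$ and off-diagonal entries $\alpha/m$, trained by gradient flow on the block-diagonal observation set $\Omega=\Omega_{\rm block}^{(s,n)}$ with all observed values equal to $w^*$. Then: (i) if $L=2$, the training dynamics are decoupled for all $m>1$; (ii) if $L\ge 3$ and $1<m<\infty$, the training dynamics are coupled; (iii) if $L\ge 3$ and $m=\infty$ (i.e. initialization $\boldsymbol W_l(0)=\alpha\boldsymbol I_d$), the training dynamics are decoupled.
   Context: Block-diagonal observation set: $\Omega_{\rm block}^{(s,n)}=\bigcup_{b=1}^n\{(i,j): i,j\in\{(b-1)s+1,\dots,bs\}\}\subseteq[d]\times[d]$. Gradient flow: with $w_{ij}=(\boldsymbol W_{L:1})_{ij}$ and $\phi(\boldsymbol W_1,\dots,\boldsymbol W_L)=\frac12\sum_{(i,j)\in\Omega}(w_{ij}-w^* )^2$, each factor follows $\dot{\boldsymbol W}_l(t)=-\partial\phi/\partial\boldsymbol W_l$ for $t\ge0$, $l\in[L]$. Coupled/decoupled dynamics: let $\boldsymbol\theta(t)$ be the vector of all trainable parameters (all entries of all factors) along the gradient flow. The dynamics are decoupled if there is a partition of $\Omega$ into $K\ge2$ non-empty disjoint subsets $\Omega_1,\dots,\Omega_K$ such that for all $k\ne l$,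 all $(i,j)\in\Omega_k$, $(p,q)\in\Omega_l$ and all $t\ge0$, $\langle\nabla_{\boldsymbol\theta}w_{ij}(t),\nabla_{\boldsymbol\theta}w_{pq}(t)\rangle=0$. The dynamics are coupled if they are not decoupled. *)

theory Defs
  imports
    "HOL-Analysis.Derivative"
    "HOL-Library.Extended_Real"
    "HOL-Library.Disjoint_Sets"
    "Jordan_Normal_Form.Matrix"
begin

(* A parameter point is a map from layer indices to factors; only the layers 1..L are
   trainable.  Matrix entries are indexed from 0, so [d] is {..<d}. *)

fun end_to_end :: "nat \<Rightarrow> nat \<Rightarrow> (nat \<Rightarrow> real mat) \<Rightarrow> real mat" where
  "end_to_end d 0 W = 1\<^sub>m d"
| "end_to_end d (Suc l) W = W (Suc l) * end_to_end d l W"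

(* The 0-based form of: the union over b = 1..n of {(b-1)s+1,...,bs} x {(b-1)s+1,...,bs}. *)
definition omega_block :: "nat \<Rightarrow> nat \<Rightarrow> (nat \<times> nat) set" where
  "omega_block s n = (\<Union>b<n. {b * s..<(b + 1) * s} \<times> {b * s..<(b + 1) * s})"

definition loss ::
  "nat \<Rightarrow> nat \<Rightarrow> (nat \<times> nat) set \<Rightarrow> real \<Rightarrow> (nat \<Rightarrow> real mat) \<Rightarrow> real" where
  "loss d L \<Omega> wstar W = 1 / 2 * (\<Sum>ij\<in>\<Omega>. (end_to_end d L W $$ ij - wstar)\<^sup>2)"

(* The partial derivative of F at W with respect to entry ij of the factor in layer l. *)
definition partial_deriv ::
  "((nat \<Rightarrow> real mat) \<Rightarrow> real) \<Rightarrow> (nat \<Rightarrow> real mat) \<Rightarrow> nat \<Rightarrow> nat \<times> nat \<Rightarrow> real" where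
  "partial_deriv F W l ij = deriv (\<lambda>x. F (W(l := (W l |\<^sub>m ij \<mapsto> x)))) (W l $$ ij)"

(* The Euclidean inner product of the gradients of F and G at W with respect to all
   entries of all factors in layers 1..L. *)
definition grad_inner ::
  "nat \<Rightarrow> nat \<Rightarrow> ((nat \<Rightarrow> real mat) \<Rightarrow> real) \<Rightarrow> ((nat \<Rightarrow> real mat) \<Rightarrow> real)
    \<Rightarrow> (nat \<Rightarrow> real mat) \<Rightarrow> real" where
  "grad_inner d L F G W =
     (\<Sum>l\<in>{1..L}. \<Sum>ij\<in>{..<d} \<times> {..<d}. partial_deriv F W l ij * partial_deriv G W l ij)"

(* W t l is the factor in layer l at time t; at t = 0 the time derivative is one-sided. *)
definition gradient_flow ::
  "nat \<Rightarrow> nat \<Rightarrow> (nat \<times> nat) set \<Rightarrow> real \<Rightarrow> (real \<Rightarrow> nat \<Rightarrow> real mat) \<Rightarrow> bool" where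
  "gradient_flow d L \<Omega> wstar W \<longleftrightarrow>
     (\<forall>t\<ge>0. \<forall>l\<in>{1..L}. W t l \<in> carrier_mat d d \<and>
        (\<forall>ij\<in>{..<d} \<times> {..<d}.
           ((\<lambda>\<tau>. W \<tau> l $$ ij) has_real_derivative
              - partial_deriv (loss d L \<Omega> wstar) (W t) l ij) (at t within {0..})))"

definition decoupled ::
  "nat \<Rightarrow> nat \<Rightarrow> (nat \<times> nat) set \<Rightarrow> (real \<Rightarrow> nat \<Rightarrow> real mat) \<Rightarrow> bool" where
  "decoupled d L \<Omega> W \<longleftrightarrow>
     (\<exists>P. partition_on \<Omega> P \<and> finite P \<and> card P \<ge> 2 \<and>
        (\<forall>A\<in>P. \<forall>B\<in>P. A \<noteq> B \<longrightarrow>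
           (\<forall>ij\<in>A. \<forall>pq\<in>B. \<forall>t\<ge>0.
              grad_inner d L (\<lambda>V. end_to_end d L V $$ ij) (\<lambda>V. end_to_end d L V $$ pq) (W t)
                = 0)))"

definition coupled ::
  "nat \<Rightarrow> nat \<Rightarrow> (nat \<times> nat) set \<Rightarrow> (real \<Rightarrow> nat \<Rightarrow> real mat) \<Rightarrow> bool" where
  "coupled d L \<Omega> W \<longleftrightarrow> \<not> decoupled d L \<Omega> W"

(* The parameter m is an extended real so that m = \<infinity> is an admissible value;
   \<alpha> / \<infinity> = 0 in ereal. *)
definition init_mat :: "nat \<Rightarrow> real \<Rightarrow> ereal \<Rightarrow> real mat" where
  "init_mat d \<alpha> m =
     mat d d (\<lambda>(i, j). if i = j then \<alpha> else real_of_ereal (ereal \<alpha> / m))"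

lemma init_mat_finite:
  assumes "r > 1"
  shows "init_mat d \<alpha> (ereal r) = mat d d (\<lambda>(i, j). if i = j then \<alpha> else \<alpha> / r)"
  using assms by (intro eq_matI) (auto simp: init_mat_def ereal_divide)

lemma init_mat_infinity: "init_mat d \<alpha> \<infinity> = \<alpha> \<cdot>\<^sub>m 1\<^sub>m d"
  by (rule eq_matI) (auto simp: init_mat_def)

end

theory Submission
  imports Defs
begin

text \<open>
  With \<open>A\<^sub>l = W\<^sub>L \<cdots> W\<^sub>l\<^sub>+\<^sub>1\<close> and \<open>B\<^sub>l = W\<^sub>l\<^sub>-\<^sub>1 \<cdots> W\<^sub>1\<close>, the inner product of the gradients of
  \<open>w\<^sub>i\<^sub>j\<close> and \<open>w\<^sub>p\<^sub>q\<close> is the sum over \<open>l\<close> of \<open>(A\<^sub>l A\<^sub>l\<^sup>T)\<^sub>i\<^sub>p (B\<^sub>l\<^sup>T B\<^sub>l)\<^sub>j\<^sub>q\<close>. For \<open>L = 2\<close> one of the two matrices in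
  each term is the identity, so distinct blocks never interact. For \<open>L \<ge> 3\<close> and finite \<open>m\<close> all
  entries at time \<open>0\<close> are positive, so the term \<open>l = 2\<close> makes every inner product positive. For
  \<open>m = \<infinity>\<close> the block-diagonal matrices are invariant under the flow: on a bounded time interval the
  gradient of the loss in the off-block entries is at most linear in their size, so by Gronwall's
  inequality they stay zero, and then so do the inner products between blocks.
\<close>

section \<open>Products of factors and their derivatives\<close>

lemma end_to_end_carrier:
  assumes "\<forall>r\<in>{1..k}. W r \<in> carrier_mat d d"
  shows "end_to_end d k W \<in> carrier_mat d d"
  using assms by (induction k) (auto intro!: mult_carrier_mat)

lemma end_to_end_cong:
  assumes "\<And>r. r \<in> {1..k} \<Longrightarrow> V r = W r"
  shows "end_to_end d k V = end_to_end d k W"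
  using assms by (induction k) auto

lemma end_to_end_add:
  assumes "\<forall>r\<in>{1..k + l}. W r \<in> carrier_mat d d"
  shows "end_to_end d (k + l) W = end_to_end d k (\<lambda>r. W (l + r)) * end_to_end d l W"
  using assms
proof (induction k)
  case 0
  then show ?case using end_to_end_carrier[of l W d] by simp
next
  case (Suc k)
  have "end_to_end d l W \<in> carrier_mat d d" "W (Suc (l + k)) \<in> carrier_mat d d"
    "end_to_end d k (\<lambda>r. W (l + r)) \<in> carrier_mat d d"
    using Suc.prems by (auto intro!: end_to_end_carrier)
  then have "W (Suc (l + k)) * end_to_end d k (\<lambda>r. W (l + r)) * end_to_end d l W =
      W (Suc (l + k)) * (end_to_end d k (\<lambda>r. W (l + r)) * end_to_end d l W)"
    by (intro assoc_mult_mat)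
  with Suc show ?case by (simp add: add.commute[of k l])
qed

text \<open>Isolates the factor of layer \<open>l\<close> between the layers above it, renumbered
  from 1 by the shift, and the layers below it. This makes the product visibly linear in each single
  factor.\<close>

lemma end_to_end_split:
  assumes "\<forall>r\<in>{1..L}. W r \<in> carrier_mat d d" "l \<in> {1..L}"
  shows "end_to_end d L W =
    end_to_end d (L - l) (\<lambda>r. W (l + r)) * (W l * end_to_end d (l - 1) W)"
proof -
  obtain k where k: "l = Suc k" using assms(2) by (cases l) auto
  have "end_to_end d (L - l + l) W = end_to_end d (L - l) (\<lambda>r. W (l + r)) * end_to_end d l W"
    using assms by (intro end_to_end_add) auto
  then show ?thesis using assms(2) by (simp only: atLeastAtMost_iff le_add_diff_inverse2) (simp add: k)
qed

lemma mult_mat_entry: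
  assumes "A \<in> carrier_mat d d" "B \<in> carrier_mat d d" "i < d" "j < d"
  shows "(A * B) $$ (i, j) = (\<Sum>k<d. A $$ (i, k) * B $$ (k, j))"
  using assms by (auto simp: scalar_prod_def atLeast0LessThan intro!: sum.cong)

text \<open>Changing entry \<open>(a, b)\<close> of \<open>X\<close> adds a multiple of the matrix
  unit at \<open>(a, b)\<close>, so the outer product changes by that multiple of column
  \<open>a\<close> of \<open>A\<close> times row \<open>b\<close> of \<open>B\<close>.\<close>

lemma triple_mult_update_entry:
  fixes A X B :: "real mat"
  assumes "A \<in> carrier_mat d d" "X \<in> carrier_mat d d" "B \<in> carrier_mat d d"
    and "i < d" "j < d" "a < d" "b < d"
  shows "(A * ((X |\<^sub>m (a, b) \<mapsto> x) * B)) $$ (i, j) =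
    (A * (X * B)) $$ (i, j) + A $$ (i, a) * B $$ (b, j) * (x - X $$ (a, b))"
proof -
  let ?Y = "X |\<^sub>m (a, b) \<mapsto> x"
  have Y: "?Y \<in> carrier_mat d d" using assms(2) by auto
  have ent: "?Y $$ (p, q) = X $$ (p, q) + (if p = a then if q = b then x - X $$ (a, b) else 0 else 0)"
    if "p < d" "q < d" for p q
    using that assms(2) by (auto simp: update_mat_def)
  have YB: "(?Y * B) $$ (p, j) = (X * B) $$ (p, j) + (if p = a then (x - X $$ (a, b)) * B $$ (b, j) else 0)"
    if "p < d" for p
    unfolding mult_mat_entry[OF Y assms(3) that assms(5)] mult_mat_entry[OF assms(2,3) that assms(5)]
    using that assms(7)
    by (auto simp: ent distrib_right sum.distrib if_distrib[of "\<lambda>z. z * _"] cong: if_cong)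
  have car: "?Y * B \<in> carrier_mat d d" "X * B \<in> carrier_mat d d"
    using Y assms(2,3) by (auto intro!: mult_carrier_mat)
  show ?thesis
    unfolding mult_mat_entry[OF assms(1) car(1) assms(4,5)] mult_mat_entry[OF assms(1) car(2) assms(4,5)]
    using assms(6)
    by (simp add: YB distrib_left sum.distrib if_distrib[of "\<lambda>z. _ * z"] mult_ac cong: if_cong)
qed

text \<open>As a function of one entry of one factor, every entry of the product is affine; its
  slope is therefore the same at every \<open>x\<close>.\<close>

lemma end_to_end_has_derivative:
  assumes W: "\<forall>r\<in>{1..L}. W r \<in> carrier_mat d d" and l: "l \<in> {1..L}"
    and ij: "i < d" "j < d" and ab: "a < d" "b < d"
  shows "((\<lambda>x. end_to_end d L (W(l := (W l |\<^sub>m (a, b) \<mapsto> x))) $$ (i, j)) has_real_derivative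
    end_to_end d (L - l) (\<lambda>r. W (l + r)) $$ (i, a) * end_to_end d (l - 1) W $$ (b, j)) (at x)"
proof -
  let ?A = "end_to_end d (L - l) (\<lambda>r. W (l + r))" and ?B = "end_to_end d (l - 1) W"
  have A: "?A \<in> carrier_mat d d" and B: "?B \<in> carrier_mat d d" and Wl: "W l \<in> carrier_mat d d"
    using W l by (auto intro!: end_to_end_carrier)
  have eq: "end_to_end d L (W(l := (W l |\<^sub>m (a, b) \<mapsto> x))) $$ (i, j) =
     end_to_end d L W $$ (i, j) + ?A $$ (i, a) * ?B $$ (b, j) * (x - W l $$ (a, b))" for x
  proof -
    let ?V = "W(l := (W l |\<^sub>m (a, b) \<mapsto> x))"
    have V: "\<forall>r\<in>{1..L}. ?V r \<in> carrier_mat d d" using W Wl by (auto simp: update_mat_def)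
    have "end_to_end d (L - l) (\<lambda>r. ?V (l + r)) = ?A" "end_to_end d (l - 1) ?V = ?B"
      by (rule end_to_end_cong; use l in auto)+
    then have "end_to_end d L ?V = ?A * ((W l |\<^sub>m (a, b) \<mapsto> x) * ?B)"
      using end_to_end_split[OF V l] by (simp only: fun_upd_same)
    then show ?thesis
      using triple_mult_update_entry[OF A Wl B ij ab] end_to_end_split[OF W l] by simp
  qed
  show ?thesis unfolding eq by (auto intro!: derivative_eq_intros)
qed

lemma partial_deriv_end_to_end:
  assumes "\<forall>r\<in>{1..L}. W r \<in> carrier_mat d d" "l \<in> {1..L}"
    and "i < d" "j < d" "a < d" "b < d"
  shows "partial_deriv (\<lambda>V. end_to_end d L V $$ (i, j)) W l (a, b) =
    end_to_end d (L - l) (\<lambda>r. W (l + r)) $$ (i, a) * end_to_end d (l - 1) W $$ (b, j)"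
  unfolding partial_deriv_def
  by (rule DERIV_imp_deriv, rule end_to_end_has_derivative[OF assms])

text \<open>Each partial derivative is a term in \<open>a\<close> times a term in \<open>b\<close>,
  so for every layer the double sum over \<open>(a, b)\<close> factors: an inner product of rows
  \<open>i\<close> and \<open>p\<close> of the upper product times one of columns \<open>j\<close>
  and \<open>q\<close> of the lower product.\<close>

lemma grad_inner_end_to_end:
  assumes W: "\<forall>r\<in>{1..L}. W r \<in> carrier_mat d d"
    and "i < d" "j < d" "p < d" "q < d"
  shows "grad_inner d L (\<lambda>V. end_to_end d L V $$ (i, j)) (\<lambda>V. end_to_end d L V $$ (p, q)) W =
    (\<Sum>l\<in>{1..L}.
      (\<Sum>a<d. end_to_end d (L - l) (\<lambda>r. W (l + r)) $$ (i, a) *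
              end_to_end d (L - l) (\<lambda>r. W (l + r)) $$ (p, a)) *
      (\<Sum>b<d. end_to_end d (l - 1) W $$ (b, j) * end_to_end d (l - 1) W $$ (b, q)))"
  unfolding grad_inner_def sum_product sum.cartesian_product
  using assms
  by (intro sum.cong refl) (auto simp: partial_deriv_end_to_end algebra_simps)

text \<open>Chain rule over the observed entries; the 2 from the square cancels the
  \<open>1 / 2\<close> in the loss.\<close>

lemma partial_deriv_loss:
  assumes W: "\<forall>r\<in>{1..L}. W r \<in> carrier_mat d d" and l: "l \<in> {1..L}"
    and ab: "a < d" "b < d" and \<Omega>: "\<Omega> \<subseteq> {..<d} \<times> {..<d}"
  shows "partial_deriv (loss d L \<Omega> wstar) W l (a, b) =
    (\<Sum>(i, j)\<in>\<Omega>. (end_to_end d L W $$ (i, j) - wstar) *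
      (end_to_end d (L - l) (\<lambda>r. W (l + r)) $$ (i, a) * end_to_end d (l - 1) W $$ (b, j)))"
proof -
  let ?V = "\<lambda>x. W(l := (W l |\<^sub>m (a, b) \<mapsto> x))"
  let ?D = "\<lambda>ij. end_to_end d (L - l) (\<lambda>r. W (l + r)) $$ (fst ij, a) * end_to_end d (l - 1) W $$ (b, snd ij)"
  \<comment> \<open>Writing the current value back leaves \<open>W\<close> unchanged, so the chain
    rule at this point yields the residual of \<open>W\<close> itself.\<close>
  have V0: "?V (W l $$ (a, b)) = W"
    using W l ab by (intro ext) (auto simp: update_mat_def)
  have "((\<lambda>x. (end_to_end d L (?V x) $$ ij - wstar)\<^sup>2) has_real_derivative
      2 * (end_to_end d L W $$ ij - wstar) * ?D ij) (at (W l $$ (a, b)))" if "ij \<in> \<Omega>" for ij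
  proof -
    have ij: "fst ij < d" "snd ij < d" using that \<Omega> by auto
    show ?thesis
      using end_to_end_has_derivative[OF W l ij ab, of "W l $$ (a, b)"]
      by (auto intro!: derivative_eq_intros simp: V0)
  qed
  then have "((\<lambda>x. loss d L \<Omega> wstar (?V x)) has_real_derivative
      1 / 2 * (\<Sum>ij\<in>\<Omega>. 2 * (end_to_end d L W $$ ij - wstar) * ?D ij)) (at (W l $$ (a, b)))"
    unfolding loss_def by (intro DERIV_cmult DERIV_sum) auto
  then show ?thesis
    unfolding partial_deriv_def
    by (subst DERIV_imp_deriv, assumption)
      (auto simp: sum_distrib_left case_prod_unfold intro!: sum.cong)
qed

section \<open>Almost block-diagonal matrices\<close>

text \<open>The off-block bound is \<open>c * e\<close> rather than \<open>e\<close>, which makes the predicate multiplicative in \<open>c\<close>.\<close>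

definition block_small :: "(nat \<Rightarrow> nat) \<Rightarrow> nat \<Rightarrow> real \<Rightarrow> real \<Rightarrow> real mat \<Rightarrow> bool" where
  "block_small \<beta> d c e A \<longleftrightarrow> A \<in> carrier_mat d d \<and>
     (\<forall>i<d. \<forall>j<d. \<bar>A $$ (i, j)\<bar> \<le> c \<and> (\<beta> i \<noteq> \<beta> j \<longrightarrow> \<bar>A $$ (i, j)\<bar> \<le> c * e))"

lemma block_smallD:
  assumes "block_small \<beta> d c e A" "i < d" "j < d"
  shows "\<bar>A $$ (i, j)\<bar> \<le> c" and "\<beta> i \<noteq> \<beta> j \<Longrightarrow> \<bar>A $$ (i, j)\<bar> \<le> c * e"
  using assms by (auto simp: block_small_def)

lemma block_small_mono:
  assumes "block_small \<beta> d c e A" "c \<le> c'" "0 \<le> e"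
  shows "block_small \<beta> d c' e A"
  using assms mult_right_mono[OF assms(2,3)] unfolding block_small_def by (meson order_trans)

text \<open>If \<open>i\<close> and \<open>j\<close> lie in different blocks, no \<open>k\<close>
  shares a block with both. Hence each of the \<open>d\<close> summands contains an off-block entry
  of \<open>A\<close> or of \<open>B\<close>, which contributes one factor \<open>e\<close>.\<close>

lemma block_small_mult:
  assumes A: "block_small \<beta> d c e A" and B: "block_small \<beta> d c' e B"
    and "0 \<le> c" "0 \<le> c'" "0 \<le> e"
  shows "block_small \<beta> d (d * c * c') e (A * B)"
proof -
  have car: "A \<in> carrier_mat d d" "B \<in> carrier_mat d d"
    using A B by (auto simp: block_small_def)
  have "\<bar>(A * B) $$ (i, j)\<bar> \<le> d * c * c'" if "i < d" "j < d" for i j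
  proof -
    have "\<bar>(A * B) $$ (i, j)\<bar> \<le> (\<Sum>k<d. c * c')"
      unfolding mult_mat_entry[OF car that]
      using A B that assms(3,4)
      by (intro order_trans[OF sum_abs] sum_mono) (auto simp: block_small_def abs_mult intro!: mult_mono)
    then show ?thesis by simp
  qed
  moreover have "\<bar>(A * B) $$ (i, j)\<bar> \<le> d * c * c' * e" if "i < d" "j < d" "\<beta> i \<noteq> \<beta> j" for i j
  proof -
    have "\<bar>A $$ (i, k) * B $$ (k, j)\<bar> \<le> c * c' * e" if k: "k < d" for k
    proof (cases "\<beta> i = \<beta> k")
      case True
      then have "\<bar>A $$ (i, k)\<bar> * \<bar>B $$ (k, j)\<bar> \<le> c * (c' * e)"
        using A B that \<open>i < d\<close> \<open>j < d\<close> \<open>\<beta> i \<noteq> \<beta> j\<close> assms(3-5)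
        by (intro mult_mono) (auto simp: block_small_def)
      then show ?thesis by (simp add: abs_mult mult.assoc)
    next
      case False
      then have "\<bar>A $$ (i, k)\<bar> * \<bar>B $$ (k, j)\<bar> \<le> (c * e) * c'"
        using A B that \<open>i < d\<close> \<open>j < d\<close> assms(3-5)
        by (intro mult_mono) (auto simp: block_small_def)
      then show ?thesis by (simp add: abs_mult mult_ac)
    qed
    then have "\<bar>(A * B) $$ (i, j)\<bar> \<le> (\<Sum>k<d. c * c' * e)"
      unfolding mult_mat_entry[OF car that(1,2)]
      by (intro order_trans[OF sum_abs] sum_mono) auto
    then show ?thesis by (simp add: mult.assoc)
  qed
  ultimately show ?thesis using car by (auto simp: block_small_def)
qed

text \<open>Each further factor multiplies the constant by \<open>d * c\<close>; the empty product
  is the identity, for which the constant 1 works.\<close>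

lemma block_small_end_to_end:
  assumes "\<forall>r\<in>{1..k}. block_small \<beta> d c e (W r)" "0 \<le> c" "0 \<le> e"
  shows "block_small \<beta> d ((d * c) ^ k) e (end_to_end d k W)"
  using assms
proof (induction k)
  case 0
  then show ?case by (auto simp: block_small_def)
next
  case (Suc k)
  then have "block_small \<beta> d (d * c * (d * c) ^ k) e (W (Suc k) * end_to_end d k W)"
    by (intro block_small_mult) auto
  then show ?case by simp
qed

text \<open>Since \<open>d * c\<close> is at least 1, one constant serves all partial products of at
  most \<open>L\<close> factors.\<close>

lemma block_small_end_to_end_le:
  fixes c e :: real
  assumes "\<forall>r\<in>{1..k}. block_small \<beta> d c e (W r)" "1 \<le> d" "1 \<le> c" "0 \<le> e" "k \<le> L"
  shows "block_small \<beta> d ((d * c) ^ L) e (end_to_end d k W)"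
proof -
  have "1 \<le> real d * c" using mult_mono[of 1 "real d" 1 c] assms by simp
  then show ?thesis
    using assms
    by (intro block_small_mono[OF block_small_end_to_end[OF assms(1)]] power_increasing) auto
qed

text \<open>An observed \<open>(i, j)\<close> stays within one block while \<open>(a, b)\<close>
  does not, so \<open>(i, a)\<close> or \<open>(b, j)\<close> is off-block. Every summand of the
  derivative thus carries a factor \<open>e\<close>, which is the linear bound that Gronwall's
  inequality requires.\<close>

lemma partial_deriv_loss_bound:
  fixes c e :: real
  assumes W: "\<forall>r\<in>{1..L}. block_small \<beta> d c e (W r)" and l: "l \<in> {1..L}"
    and ab: "a < d" "b < d" "\<beta> a \<noteq> \<beta> b"
    and \<Omega>: "\<Omega> \<subseteq> {..<d} \<times> {..<d}" "\<And>i j. (i, j) \<in> \<Omega> \<Longrightarrow> \<beta> i = \<beta> j"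
    and "1 \<le> c" "0 \<le> e"
  shows "\<bar>partial_deriv (loss d L \<Omega> wstar) W l (a, b)\<bar> \<le>
    card \<Omega> * (((d * c) ^ L + \<bar>wstar\<bar>) * ((d * c) ^ L * (d * c) ^ L)) * e"
proof -
  define C where "C = (d * c) ^ L"
  have C: "0 \<le> C" using \<open>1 \<le> c\<close> by (simp add: C_def)
  let ?A = "end_to_end d (L - l) (\<lambda>r. W (l + r))" and ?B = "end_to_end d (l - 1) W"
  have "1 \<le> d" using ab by simp
  have E: "block_small \<beta> d C e (end_to_end d L W)"
    and A: "block_small \<beta> d C e ?A" and B: "block_small \<beta> d C e ?B"
    unfolding C_def using W l assms(8,9) \<open>1 \<le> d\<close>
    by (intro block_small_end_to_end_le; force)+
  have car: "\<forall>r\<in>{1..L}. W r \<in> carrier_mat d d" using W by (auto simp: block_small_def)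
  have "\<bar>(end_to_end d L W $$ (i, j) - wstar) * (?A $$ (i, a) * ?B $$ (b, j))\<bar>
     \<le> (C + \<bar>wstar\<bar>) * (C * C * e)" if "(i, j) \<in> \<Omega>" for i j
  proof -
    have ij: "i < d" "j < d" "\<beta> i = \<beta> j" using that \<Omega> by auto
    have "\<bar>?A $$ (i, a) * ?B $$ (b, j)\<bar> \<le> C * C * e"
    proof (cases "\<beta> i = \<beta> a")
      case True
      then have "\<beta> b \<noteq> \<beta> j" using ij ab by simp
      then have "\<bar>?A $$ (i, a)\<bar> * \<bar>?B $$ (b, j)\<bar> \<le> C * (C * e)"
        using block_smallD(1)[OF A ij(1) ab(1)] block_smallD(2)[OF B ab(2) ij(2)] C
        by (intro mult_mono) auto
      then show ?thesis by (simp add: abs_mult mult.assoc)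
    next
      case False
      then have "\<bar>?A $$ (i, a)\<bar> * \<bar>?B $$ (b, j)\<bar> \<le> (C * e) * C"
        using block_smallD(2)[OF A ij(1) ab(1)] block_smallD(1)[OF B ab(2) ij(2)] C \<open>0 \<le> e\<close>
        by (intro mult_mono) auto
      then show ?thesis by (simp add: abs_mult mult_ac)
    qed
    moreover have "\<bar>end_to_end d L W $$ (i, j) - wstar\<bar> \<le> C + \<bar>wstar\<bar>"
      using block_smallD(1)[OF E ij(1,2)] by linarith
    ultimately show ?thesis
      unfolding abs_mult[of "end_to_end d L W $$ (i, j) - wstar"]
      using C by (intro mult_mono) auto
  qed
  then have "\<bar>partial_deriv (loss d L \<Omega> wstar) W l (a, b)\<bar> \<le>
      (\<Sum>ij\<in>\<Omega>. (C + \<bar>wstar\<bar>) * (C * C * e))"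
    unfolding partial_deriv_loss[OF car l ab(1,2) \<Omega>(1)]
    by (intro order_trans[OF sum_abs] sum_mono) auto
  then show ?thesis by (simp add: C_def mult.assoc)
qed

section \<open>Invariance of block-diagonal matrices under the flow\<close>

text \<open>With the integrating factor \<open>exp (- K * t)\<close>, the function \<open>E\<close>
  becomes nonincreasing.\<close>

lemma gronwall_nonpos:
  fixes E :: "real \<Rightarrow> real"
  assumes deriv: "\<And>t. 0 \<le> t \<Longrightarrow> t \<le> T \<Longrightarrow> (E has_real_derivative E' t) (at t within {0..})"
    and le: "\<And>t. 0 \<le> t \<Longrightarrow> t \<le> T \<Longrightarrow> E' t \<le> K * E t"
    and "E 0 \<le> 0" "0 \<le> T"
  shows "E T \<le> 0"
proof -
  let ?F = "\<lambda>t. E t * exp (- K * t)"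
  have der: "(?F has_real_derivative (E' t - K * E t) * exp (- K * t)) (at t within {0..})"
    if "0 \<le> t" "t \<le> T" for t
    using deriv[OF that] by (auto intro!: derivative_eq_intros simp: algebra_simps)
  have "?F T \<le> ?F 0"
  proof (rule DERIV_nonpos_imp_decreasing_open[OF \<open>0 \<le> T\<close>])
    fix t assume t: "0 < t" "t < T"
    \<comment> \<open>The flow has only a one-sided derivative at 0; monotonicity uses two-sided
      derivatives at interior points and continuity at the endpoints.\<close>
    then have "at t within {0..} = at t" by (intro at_within_interior) auto
    then have "(?F has_real_derivative (E' t - K * E t) * exp (- K * t)) (at t)"
      using der[of t] t by simp
    moreover have "(E' t - K * E t) * exp (- K * t) \<le> 0"
      using le[of t] t by (intro mult_nonpos_nonneg) auto
    ultimately show "\<exists>y. (?F has_real_derivative y) (at t) \<and> y \<le> 0" by blast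
  next
    show "continuous_on {0..T} ?F"
      unfolding continuous_on_eq_continuous_within
    proof
      fix t assume "t \<in> {0..T}"
      then have "continuous (at t within {0..}) ?F"
        using der[of t] by (intro DERIV_continuous) auto
      then show "continuous (at t within {0..T}) ?F"
        by (rule continuous_within_subset) auto
    qed
  qed
  with \<open>E 0 \<le> 0\<close> have "E T * exp (- K * T) \<le> 0" by simp
  then show ?thesis by (simp add: mult_le_0_iff not_le[symmetric])
qed

text \<open>The finitely many entries are continuous in time, hence bounded on the compact interval
  up to \<open>T\<close>. The bound may depend on \<open>T\<close>.\<close>

lemma gradient_flow_bounded:
  assumes flow: "gradient_flow d L \<Omega> wstar W"
  obtains c where "1 \<le> c"
    "\<And>t l i j. 0 \<le> t \<Longrightarrow> t \<le> T \<Longrightarrow> l \<in> {1..L} \<Longrightarrow> i < d \<Longrightarrow> j < d \<Longrightarrow> \<bar>W t l $$ (i, j)\<bar> \<le> c"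
proof -
  have "\<exists>c. \<forall>t\<in>{0..T}. \<bar>W t l $$ (i, j)\<bar> \<le> c" if "l \<in> {1..L}" "i < d" "j < d" for l i j
  proof -
    have "continuous_on {0..} (\<lambda>t. W t l $$ (i, j))"
      using flow that unfolding gradient_flow_def
      by (intro DERIV_continuous_on[where D = "\<lambda>t. - partial_deriv (loss d L \<Omega> wstar) (W t) l (i, j)"]) auto
    then have "compact ((\<lambda>t. W t l $$ (i, j)) ` {0..T})"
      by (intro compact_continuous_image) (auto intro: continuous_on_subset)
    then show ?thesis by (auto dest!: compact_imp_bounded simp: bounded_iff)
  qed
  then obtain f where f: "\<And>l i j t. l \<in> {1..L} \<Longrightarrow> i < d \<Longrightarrow> j < d \<Longrightarrow> t \<in> {0..T} \<Longrightarrow>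
      \<bar>W t l $$ (i, j)\<bar> \<le> f l i j"
    by metis
  \<comment> \<open>The sum stands in for a maximum, and the summand 1 guarantees
    \<open>1 \<le> c\<close>.\<close>
  define c where "c = 1 + (\<Sum>(l, i, j)\<in>{1..L} \<times> {..<d} \<times> {..<d}. \<bar>f l i j\<bar>)"
  show thesis
  proof
    show "1 \<le> c" unfolding c_def by (auto intro!: sum_nonneg)
    fix t l i j assume *: "0 \<le> t" "t \<le> T" "l \<in> {1..L}" "i < d" "j < d"
    have "\<bar>f l i j\<bar> \<le> (\<Sum>(l, i, j)\<in>{1..L} \<times> {..<d} \<times> {..<d}. \<bar>f l i j\<bar>)"
      using member_le_sum[of "(l, i, j)" "{1..L} \<times> {..<d} \<times> {..<d}" "\<lambda>(l, i, j). \<bar>f l i j\<bar>"] *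
      by auto
    with f[of l i j t] * show "\<bar>W t l $$ (i, j)\<bar> \<le> c" unfolding c_def by auto
  qed
qed

text \<open>Gronwall's inequality is applied to \<open>E\<close>, the sum of squares of all
  off-block entries of all layers. The conclusion is phrased with off-block bound
  \<open>c * 0\<close>, so that it passes directly to products of factors.\<close>

lemma gradient_flow_block_diagonal:
  assumes flow: "gradient_flow d L \<Omega> wstar W"
    and \<Omega>: "\<Omega> \<subseteq> {..<d} \<times> {..<d}" "\<And>i j. (i, j) \<in> \<Omega> \<Longrightarrow> \<beta> i = \<beta> j"
    and init: "\<And>l i j. l \<in> {1..L} \<Longrightarrow> i < d \<Longrightarrow> j < d \<Longrightarrow> \<beta> i \<noteq> \<beta> j \<Longrightarrow> W 0 l $$ (i, j) = 0"
    and T: "0 \<le> T"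
  obtains c where "1 \<le> c" "\<And>l. l \<in> {1..L} \<Longrightarrow> block_small \<beta> d c 0 (W T l)"
proof -
  obtain c where c: "1 \<le> c" and bnd: "\<And>t l i j. 0 \<le> t \<Longrightarrow> t \<le> T \<Longrightarrow> l \<in> {1..L} \<Longrightarrow>
      i < d \<Longrightarrow> j < d \<Longrightarrow> \<bar>W t l $$ (i, j)\<bar> \<le> c"
    using gradient_flow_bounded[OF flow] by metis
  define J where "J = {(l, i, j) \<in> {1..L} \<times> {..<d} \<times> {..<d}. \<beta> i \<noteq> \<beta> j}"
  have J: "finite J" unfolding J_def by (rule finite_subset[of _ "{1..L} \<times> {..<d} \<times> {..<d}"]) auto
  define g where "g t = (\<lambda>(l, ij). partial_deriv (loss d L \<Omega> wstar) (W t) l ij)" for t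
  define u where "u t = (\<lambda>(l, ij). W t l $$ ij)" for t
  define E where "E t = (\<Sum>x\<in>J. (u t x)\<^sup>2)" for t
  define C where "C = card \<Omega> * (((d * c) ^ L + \<bar>wstar\<bar>) * ((d * c) ^ L * (d * c) ^ L))"
  have C: "0 \<le> C" using c by (auto simp: C_def)
  have car: "W t l \<in> carrier_mat d d" if "0 \<le> t" "l \<in> {1..L}" for t l
    using flow that by (auto simp: gradient_flow_def)
  have E_nonneg [simp]: "0 \<le> E t" for t unfolding E_def by (intro sum_nonneg) auto
  have u_le: "\<bar>u t x\<bar> \<le> sqrt (E t)" if "x \<in> J" for t x
    unfolding E_def using J that by (intro real_le_rsqrt) (auto intro!: member_le_sum)
  \<comment> \<open>The off-block size is measured by \<open>e = sqrt (E t)\<close>; the extra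
    factor \<open>c\<close> in \<open>block_small\<close> is harmless because
    \<open>1 \<le> c\<close>.\<close>
  have small: "block_small \<beta> d c (sqrt (E t)) (W t l)" if "0 \<le> t" "t \<le> T" "l \<in> {1..L}" for t l
  proof -
    have "\<bar>W t l $$ (i, j)\<bar> \<le> c * sqrt (E t)" if "i < d" "j < d" "\<beta> i \<noteq> \<beta> j" for i j
    proof -
      have "\<bar>W t l $$ (i, j)\<bar> \<le> 1 * sqrt (E t)"
        using u_le[of "(l, i, j)" t] that \<open>l \<in> {1..L}\<close> by (auto simp: J_def u_def)
      also have "\<dots> \<le> c * sqrt (E t)" using c E_nonneg by (intro mult_right_mono) auto
      finally show ?thesis .
    qed
    then show ?thesis using car bnd that by (auto simp: block_small_def)
  qed
  have g_le: "\<bar>g t x\<bar> \<le> C * sqrt (E t)" if "0 \<le> t" "t \<le> T" "x \<in> J" for t x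
  proof -
    obtain l a b where x: "x = (l, a, b)" "l \<in> {1..L}" "a < d" "b < d" "\<beta> a \<noteq> \<beta> b"
      using \<open>x \<in> J\<close> by (auto simp: J_def)
    have "\<forall>r\<in>{1..L}. block_small \<beta> d c (sqrt (E t)) (W t r)" using small that by blast
    from partial_deriv_loss_bound[OF this x(2-5) \<Omega> c, of wstar] show ?thesis
      by (simp add: x(1) g_def C_def)
  qed
  \<comment> \<open>Each \<open>u t x * g t x\<close> is at most
    \<open>sqrt (E t) * (C * sqrt (E t)) = C * E t\<close> in absolute value; summing over
    \<open>J\<close> with the 2 from the square gives the rate
    \<open>2 * card J * C\<close>.\<close>
  have "E T \<le> 0"
  proof (rule gronwall_nonpos[where E = E and K = "2 * card J * C"])
    fix t assume t: "0 \<le> t" "t \<le> T"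
    have "((\<lambda>\<tau>. u \<tau> x) has_real_derivative - g t x) (at t within {0..})" if "x \<in> J" for x
      using flow t that by (auto simp: gradient_flow_def J_def u_def g_def)
    then show "(E has_real_derivative (\<Sum>x\<in>J. 2 * u t x * - g t x)) (at t within {0..})"
      unfolding E_def by (auto intro!: derivative_eq_intros simp: mult_ac)
    have "2 * u t x * - g t x \<le> 2 * (C * E t)" if "x \<in> J" for x
    proof -
      have "\<bar>u t x\<bar> * \<bar>g t x\<bar> \<le> sqrt (E t) * (C * sqrt (E t))"
        using u_le[OF that, of t] g_le[OF t that] by (intro mult_mono) (auto simp: E_nonneg)
      also have "\<dots> = C * E t" using E_nonneg[of t] by (simp add: mult_ac)
      finally have "\<bar>u t x * g t x\<bar> \<le> C * E t" by (simp add: abs_mult)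
      then have "- (u t x * g t x) \<le> C * E t" by (rule abs_le_D2)
      moreover have "2 * u t x * - g t x = 2 * - (u t x * g t x)" by simp
      ultimately show ?thesis by linarith
    qed
    then have "(\<Sum>x\<in>J. 2 * u t x * - g t x) \<le> (\<Sum>x\<in>J. 2 * (C * E t))" by (intro sum_mono)
    then show "(\<Sum>x\<in>J. 2 * u t x * - g t x) \<le> 2 * card J * C * E t" by (simp add: mult_ac)
  next
    show "E 0 \<le> 0" unfolding E_def using init by (auto simp: J_def u_def intro!: sum_nonpos)
  qed (rule T)
  then have "E T = 0" using E_nonneg[of T] by simp
  then show thesis using small[of T] T c by (intro that[of c]) auto
qed

section \<open>Partition into blocks\<close>

text \<open>Integer division by \<open>s\<close> gives the block index and serves as the labelling
  \<open>\<beta>\<close> of the previous results.\<close>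

lemma omega_block_iff:
  assumes "s \<ge> 1"
  shows "(i, j) \<in> omega_block s n \<longleftrightarrow> i < s * n \<and> j < s * n \<and> i div s = j div s"
proof -
  have block: "i \<in> {b * s..<(b + 1) * s} \<longleftrightarrow> i div s = b" for i b
    using assms by (auto simp: div_nat_eqI mult.commute[of s] dividend_less_div_times)
  have lt: "i div s < n \<longleftrightarrow> i < s * n" for i
    using assms by (simp add: div_less_iff_less_mult mult.commute)
  have "(i, j) \<in> omega_block s n \<longleftrightarrow> i div s < n \<and> i div s = j div s"
    unfolding omega_block_def UN_iff mem_Times_iff block by auto
  then show ?thesis using lt[of i] lt[of j] by auto
qed

text \<open>The diagonal blocks themselves are the witnessing partition, so only pairs of entries
  from different blocks remain to be checked.\<close>

lemma decoupled_blockI: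
  assumes s: "s \<ge> 1" and n: "n \<ge> 2"
    and zero: "\<And>i j p q t. i < s * n \<Longrightarrow> j < s * n \<Longrightarrow> p < s * n \<Longrightarrow> q < s * n \<Longrightarrow>
      i div s = j div s \<Longrightarrow> p div s = q div s \<Longrightarrow> i div s \<noteq> p div s \<Longrightarrow> 0 \<le> t \<Longrightarrow>
      grad_inner d L (\<lambda>V. end_to_end d L V $$ (i, j)) (\<lambda>V. end_to_end d L V $$ (p, q)) (W t) = 0"
  shows "decoupled d L (omega_block s n) W"
proof -
  let ?B = "\<lambda>b. {(i, j) \<in> omega_block s n. i div s = b}"
  \<comment> \<open>The upper left corner of a block shows that the block is nonempty and determines
    its index; hence there are \<open>n\<close> distinct classes.\<close>
  have mem: "(b * s, b * s) \<in> ?B b" if "b < n" for b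
    using that s by (auto simp: omega_block_iff mult.commute)
  have inj: "inj_on ?B {..<n}"
  proof (rule inj_onI)
    fix b c assume "b \<in> {..<n}" "?B b = ?B c"
    then have "(b * s, b * s) \<in> ?B c" using mem[of b] by simp
    then show "b = c" using s by simp
  qed
  have "partition_on (omega_block s n) (?B ` {..<n})"
  proof (rule partition_onI)
    show "\<Union> (?B ` {..<n}) = omega_block s n"
      using s by (auto simp: omega_block_iff div_less_iff_less_mult mult.commute)
    show "{} \<notin> ?B ` {..<n}" using mem by fastforce
  qed (auto simp: disjnt_def)
  moreover have "card (?B ` {..<n}) \<ge> 2" using card_image[OF inj] n by simp
  moreover have "grad_inner d L (\<lambda>V. end_to_end d L V $$ ij) (\<lambda>V. end_to_end d L V $$ pq) (W t) = 0"
    if "A \<in> ?B ` {..<n}" "B \<in> ?B ` {..<n}" "A \<noteq> B" "ij \<in> A" "pq \<in> B" "0 \<le> t" for A B ij pq t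
    using that s by (auto simp: omega_block_iff intro!: zero)
  ultimately show ?thesis unfolding decoupled_def by (intro exI[of _ "?B ` {..<n}"]) auto
qed

section \<open>Positivity of products and of gradient inner products\<close>

lemma end_to_end_pos:
  assumes "\<forall>r\<in>{1..k}. W r \<in> carrier_mat d d \<and> (\<forall>i<d. \<forall>j<d. W r $$ (i, j) > 0)"
    and "i < d" "j < d"
  shows "end_to_end d k W $$ (i, j) \<ge> 0" and "k \<ge> 1 \<Longrightarrow> end_to_end d k W $$ (i, j) > 0"
proof -
  have nonneg: "end_to_end d k W $$ (i, j) \<ge> 0 \<and> (k \<ge> 1 \<longrightarrow> end_to_end d k W $$ (i, j) > 0)"
    using assms
  proof (induction k arbitrary: i)
    case (Suc k)
    have *: "end_to_end d (Suc k) W $$ (i, j) = (\<Sum>p<d. W (Suc k) $$ (i, p) * end_to_end d k W $$ (p, j))"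
      using Suc.prems by (auto intro!: mult_mat_entry end_to_end_carrier)
    have W: "W (Suc k) $$ (i, p) > 0" if "p < d" for p using Suc.prems that by auto
    have IH: "end_to_end d k W $$ (p, j) \<ge> 0" if "p < d" for p using Suc that by auto
    \<comment> \<open>The diagonal entry is positive even for \<open>k = 0\<close>, where the
      product is the identity, so the summand \<open>p = j\<close> is always strictly
      positive.\<close>
    have "end_to_end d k W $$ (j, j) > 0"
      using Suc.IH[of j] Suc.prems by (cases "k = 0") auto
    then have "0 < (\<Sum>p<d. W (Suc k) $$ (i, p) * end_to_end d k W $$ (p, j))"
      using Suc.prems W IH
      by (intro sum_pos2[of _ j] mult_pos_pos mult_nonneg_nonneg) (auto simp: less_imp_le)
    then show ?case using * by simp
  qed auto
  then show "end_to_end d k W $$ (i, j) \<ge> 0" "k \<ge> 1 \<Longrightarrow> end_to_end d k W $$ (i, j) > 0" by auto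
qed

text \<open>Layer 2 has at least one layer on each side when \<open>L \<ge> 3\<close>, so both of
  its products are entrywise positive. The other layers contribute nonnegative terms.\<close>

lemma grad_inner_pos:
  assumes W: "\<forall>r\<in>{1..L}. W r \<in> carrier_mat d d \<and> (\<forall>i<d. \<forall>j<d. W r $$ (i, j) > 0)"
    and L: "L \<ge> 3" and ij: "i < d" "j < d" "p < d" "q < d"
  shows "grad_inner d L (\<lambda>V. end_to_end d L V $$ (i, j)) (\<lambda>V. end_to_end d L V $$ (p, q)) W > 0"
proof -
  have car: "\<forall>r\<in>{1..L}. W r \<in> carrier_mat d d" using W by auto
  have d: "{..<d} \<noteq> {}" using ij by auto
  let ?A = "\<lambda>l. end_to_end d (L - l) (\<lambda>r. W (l + r))" and ?B = "\<lambda>l. end_to_end d (l - 1) W"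
  have nonneg: "?A l $$ (a, b) \<ge> 0" "?B l $$ (a, b) \<ge> 0" if "l \<in> {1..L}" "a < d" "b < d" for l a b
    using W that by (auto intro!: end_to_end_pos(1))
  have pos: "?A 2 $$ (a, b) > 0" "?B 2 $$ (a, b) > 0" if "a < d" "b < d" for a b
    by (rule end_to_end_pos(2)[of _ _ d]; use W that L in auto)+
  let ?T = "\<lambda>l. (\<Sum>a<d. ?A l $$ (i, a) * ?A l $$ (p, a)) * (\<Sum>b<d. ?B l $$ (b, j) * ?B l $$ (b, q))"
  have "?T l \<ge> 0" if "l \<in> {1..L}" for l
    using nonneg[OF that] ij by (intro mult_nonneg_nonneg sum_nonneg) auto
  moreover have "?T 2 > 0"
  proof (rule mult_pos_pos)
    show "0 < (\<Sum>a<d. ?A 2 $$ (i, a) * ?A 2 $$ (p, a))"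
      using d ij by (intro sum_pos mult_pos_pos pos) auto
    show "0 < (\<Sum>b<d. ?B 2 $$ (b, j) * ?B 2 $$ (b, q))"
      using d ij by (intro sum_pos mult_pos_pos pos) auto
  qed
  ultimately show ?thesis
    unfolding grad_inner_end_to_end[OF car ij] using L by (intro sum_pos2[of _ 2]) auto
qed

section \<open>Decoupling and coupling in the three regimes of depth and initialization\<close>

theorem proposition3p2:
  fixes s n d L :: nat and wstar \<alpha> :: real and m :: ereal
    and W :: "real \<Rightarrow> nat \<Rightarrow> real mat"
  assumes "s \<ge> 1" and "n \<ge> 2" and "d = s * n"
    and "wstar > 0" and "\<alpha> > 0" and "m > 1"
    and "gradient_flow d L (omega_block s n) wstar W"
    and "\<forall>l\<in>{1..L}. W 0 l = init_mat d \<alpha> m"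
  shows "(L = 2 \<longrightarrow> decoupled d L (omega_block s n) W) \<and>
         (L \<ge> 3 \<and> m < \<infinity> \<longrightarrow> coupled d L (omega_block s n) W) \<and>
         (L \<ge> 3 \<and> m = \<infinity> \<longrightarrow> decoupled d L (omega_block s n) W)"
proof (intro conjI impI)
  have car: "\<forall>r\<in>{1..L}. W t r \<in> carrier_mat d d" if "0 \<le> t" for t
    using assms(7) that by (auto simp: gradient_flow_def)
  show "decoupled d L (omega_block s n) W" if L: "L = 2"
  proof (rule decoupled_blockI[OF assms(1,2)])
    fix i j p q t
    assume ij: "i < s * n" "j < s * n" "p < s * n" "q < s * n"
      and "i div s = j div s" "p div s = q div s" "i div s \<noteq> p div s" and t: "(0::real) \<le> t"
    then have ne: "i \<noteq> p" "j \<noteq> q" by auto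
    \<comment> \<open>For layer 1 the lower product is empty, for layer 2 the upper one. Distinct
      rows or columns of the identity are orthogonal, so both terms vanish.\<close>
    have zero: "(\<Sum>a<d. 1\<^sub>m d $$ (i, a) * 1\<^sub>m d $$ (p, a)) = (0::real)"
      "(\<Sum>b<d. 1\<^sub>m d $$ (b, j) * 1\<^sub>m d $$ (b, q)) = (0::real)"
      using ij ne assms(3) by (auto intro!: sum.neutral)
    have "{1..L} = {1, 2}" using L by auto
    then show "grad_inner d L (\<lambda>V. end_to_end d L V $$ (i, j)) (\<lambda>V. end_to_end d L V $$ (p, q)) (W t) = 0"
      using ij assms(3) zero L by (subst grad_inner_end_to_end[OF car[OF t]]) auto
  qed
  \<comment> \<open>Any admissible partition has two distinct nonempty classes, and one entry from
    each already gives a positive inner product at time 0.\<close>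
  show "coupled d L (omega_block s n) W" if L: "L \<ge> 3 \<and> m < \<infinity>"
    unfolding coupled_def
  proof
    assume "decoupled d L (omega_block s n) W"
    then obtain P where P: "partition_on (omega_block s n) P" "card P \<ge> 2"
      and zero: "\<And>A B ij pq. A \<in> P \<Longrightarrow> B \<in> P \<Longrightarrow> A \<noteq> B \<Longrightarrow> ij \<in> A \<Longrightarrow> pq \<in> B \<Longrightarrow>
        grad_inner d L (\<lambda>V. end_to_end d L V $$ ij) (\<lambda>V. end_to_end d L V $$ pq) (W 0) = 0"
      unfolding decoupled_def by auto
    obtain A B where AB: "A \<in> P" "B \<in> P" "A \<noteq> B"
      using P(2) by (meson card_2_iff' obtain_subset_with_card_n subsetD)
    then obtain i j p q where ij: "(i, j) \<in> A" "(p, q) \<in> B"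
      using partition_onD3[OF P(1)] by (metis ex_in_conv surj_pair)
    then have "(i, j) \<in> omega_block s n" "(p, q) \<in> omega_block s n"
      using AB partition_onD1[OF P(1)] by auto
    then have lt: "i < d" "j < d" "p < d" "q < d"
      using omega_block_iff[OF assms(1)] assms(3) by auto
    obtain r where r: "m = ereal r" "r > 1" using L assms(6) by (cases m) auto
    have "W 0 l $$ (a, b) > 0" if "l \<in> {1..L}" "a < d" "b < d" for l a b
      using assms(5,8) that r by (auto simp: init_mat_finite)
    then have "grad_inner d L (\<lambda>V. end_to_end d L V $$ (i, j)) (\<lambda>V. end_to_end d L V $$ (p, q)) (W 0) > 0"
      using car[of 0] L lt by (intro grad_inner_pos) auto
    then show False using zero[OF AB ij] by simp
  qed
  show "decoupled d L (omega_block s n) W" if L: "L \<ge> 3 \<and> m = \<infinity>"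
  proof (rule decoupled_blockI[OF assms(1,2)])
    fix i j p q t
    assume ij: "i < s * n" "j < s * n" "p < s * n" "q < s * n"
      and blocks: "i div s = j div s" "p div s = q div s" "i div s \<noteq> p div s" and t: "(0::real) \<le> t"
    let ?\<beta> = "\<lambda>i. i div s"
    obtain c where c: "1 \<le> c" "\<And>l. l \<in> {1..L} \<Longrightarrow> block_small ?\<beta> d c 0 (W t l)"
    proof (rule gradient_flow_block_diagonal[OF assms(7) _ _ _ t, of ?\<beta>])
      show "omega_block s n \<subseteq> {..<d} \<times> {..<d}"
        using assms(1,3) by (auto simp: omega_block_iff)
      show "?\<beta> i = ?\<beta> j" if "(i, j) \<in> omega_block s n" for i j
        using that assms(1) by (auto simp: omega_block_iff)
      show "W 0 l $$ (i, j) = 0" if "l \<in> {1..L}" "i < d" "j < d" "?\<beta> i \<noteq> ?\<beta> j" for l i j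
        using that assms(8) L by (auto simp: init_mat_infinity)
    qed auto
    \<comment> \<open>Rows \<open>i\<close> and \<open>p\<close> of a block-diagonal matrix are
      supported in the different blocks of \<open>i\<close> and \<open>p\<close>, so at every column
      \<open>a\<close> one of the two entries is zero.\<close>
    have zero: "(\<Sum>a<d. end_to_end d (L - l) (\<lambda>r. W t (l + r)) $$ (i, a) *
        end_to_end d (L - l) (\<lambda>r. W t (l + r)) $$ (p, a)) = 0" if "l \<in> {1..L}" for l
    proof (intro sum.neutral ballI)
      fix a assume "a \<in> {..<d}"
      have "block_small ?\<beta> d ((d * c) ^ (L - l)) 0 (end_to_end d (L - l) (\<lambda>r. W t (l + r)))"
        using c that by (intro block_small_end_to_end) auto
      then show "end_to_end d (L - l) (\<lambda>r. W t (l + r)) $$ (i, a) *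
          end_to_end d (L - l) (\<lambda>r. W t (l + r)) $$ (p, a) = 0"
        using ij blocks \<open>a \<in> {..<d}\<close> assms(3) by (cases "?\<beta> i = ?\<beta> a") (auto simp: block_small_def)
    qed
    show "grad_inner d L (\<lambda>V. end_to_end d L V $$ (i, j)) (\<lambda>V. end_to_end d L V $$ (p, q)) (W t) = 0"
      using ij assms(3) zero by (subst grad_inner_end_to_end[OF car[OF t]]) (auto intro!: sum.neutral)
  qed
qed

end
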